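(* Let $m=q\geq 2$ be integers. For every integer $k$ with $0 \leq k \leq \frac{m-1}{2}$, set $B = m^2-(2k+1)m$. Then $(MR)^kM(MR)^BR(MR)^k$ generates a self-conjugate CMP of $m^{B+2(k+1)}$.
   Context: Let $m\ge 2$ be an integer. A partition $\lambda$ of a positive integer is $m$-ary if all its parts are powers $m^i$, $i\ge 0$ (so $m^0=1$ is allowed). If $a_i$ is the number of times the part $m^i$ appears in $\lambda$, one writes $\lambda=(a_k,a_{k-1},\ldots,a_0)_m$, where $a_k\neq 0$ and $a_i=0$ for $i>k$. A CMP (conjugate $m$-ary partition, i.e. conjugate $(m,m)$-ary partition) is an $m$-ary partition $\lambda$ whose conjugate $\lambda'$ is also $m$-ary; it is self-conjugate if $\lambda=\lambda'$. On CMPs $\lambda=(a_k,\ldots,a_0)_m$ define the operators (each producing a CMP; here $q=m$): raise $R(\lambda)=(ma_k,\ldots,ma_0)_m$ and migration $M(\lambda)=(1,a_k-1,a_{k-1},\ldots,a_0)_m$. Sequences of operators are composed as functions (rightmost applied first); a sequence $A$ generates the partition $A(1)_m$, where $(1)_m$ is the trivial partition of $1$. *)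

theory Defs
  imports Complex_Main "HOL-Library.Multiset"
begin

text \<open>A partition of a natural number is the multiset of its (positive) parts.\<close>

definition is_partition :: "nat multiset \<Rightarrow> nat \<Rightarrow> bool" where
  "is_partition lam n \<longleftrightarrow> 0 \<notin># lam \<and> \<Sum>\<^sub># lam = n"

text \<open>The \<open>j\<close>-th part of the conjugate is the number of parts that are at least \<open>j\<close>,
  where \<open>j\<close> runs from 1 to the largest part. The 0 in the maximum only serves to give
  the empty partition itself as its conjugate.\<close>

definition conjugate :: "nat multiset \<Rightarrow> nat multiset" where
  "conjugate lam =
     {# size {# p \<in># lam. j \<le> p #}. j \<in># mset_set {1..Max (insert 0 (set_mset lam))} #}"

definition self_conjugate :: "nat multiset \<Rightarrow> bool" where
  "self_conjugate lam \<longleftrightarrow> lam = conjugate lam"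

definition m_ary :: "nat \<Rightarrow> nat multiset \<Rightarrow> bool" where
  "m_ary m lam \<longleftrightarrow> (\<exists>n>0. is_partition lam n) \<and> (\<forall>p\<in>#lam. \<exists>i. p = m ^ i)"

definition conjugate_ary :: "nat \<Rightarrow> nat \<Rightarrow> nat multiset \<Rightarrow> bool" where
  "conjugate_ary m q lam \<longleftrightarrow> m_ary m lam \<and> m_ary q (conjugate lam)"

definition CMP :: "nat \<Rightarrow> nat multiset \<Rightarrow> bool" where
  "CMP m lam \<longleftrightarrow> conjugate_ary m m lam"

text \<open>\<open>of_mults m [a\<^sub>k, \<dots>, a\<^sub>0]\<close> is the partition \<open>(a\<^sub>k, \<dots>, a\<^sub>0)\<^sub>m\<close>, in which
  \<open>m ^ i\<close> occurs \<open>a\<^sub>i\<close> times; the highest power comes first.\<close>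

primrec of_mults :: "nat \<Rightarrow> nat list \<Rightarrow> nat multiset" where
  "of_mults m [] = {#}"
| "of_mults m (a # as) = replicate_mset a (m ^ length as) + of_mults m as"

definition top_exponent :: "nat \<Rightarrow> nat multiset \<Rightarrow> nat" where
  "top_exponent m lam = (GREATEST i. m ^ i \<in># lam)"

text \<open>The inverse: \<open>mults m lam\<close> is the list \<open>[a\<^sub>k, \<dots>, a\<^sub>0]\<close> of a nonempty
  \<open>m\<close>-ary partition \<open>lam\<close>, with \<open>a\<^sub>k \<noteq> 0\<close> (for \<open>m \<ge> 2\<close>).\<close>

definition mults :: "nat \<Rightarrow> nat multiset \<Rightarrow> nat list" where
  "mults m lam = map (\<lambda>i. count lam (m ^ i)) (rev [0..<Suc (top_exponent m lam)])"

definition raise :: "nat \<Rightarrow> nat multiset \<Rightarrow> nat multiset" where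
  "raise m lam = of_mults m (map (\<lambda>a. m * a) (mults m lam))"

text \<open>The subtraction of naturals does not truncate on \<open>m\<close>-ary partitions, since there
  the leading multiplicity \<open>a\<^sub>k\<close> is positive.\<close>

definition migration :: "nat \<Rightarrow> nat multiset \<Rightarrow> nat multiset" where
  "migration m lam = (let as = mults m lam in of_mults m (1 # (hd as - 1) # tl as))"

end

theory Submission
  imports Defs
begin

text \<open>
  The multiplicities of a partition into powers of \<open>m\<close> obscure what the operators do; the
  numbers \<open>N i\<close> of parts that are at least \<open>m ^ i\<close> make it plain. If \<open>m ^ T\<close> is the
  largest part, raising multiplies every \<open>N i\<close> by \<open>m\<close>, whereas migration turns one part
  \<open>m ^ T\<close> into \<open>m ^ (T + 1)\<close>, which leaves \<open>N 0, \<dots>, N T\<close> alone and adds the new value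
  \<open>N (T + 1) = 1\<close>. Starting from the partition of 1, every \<open>N i\<close> therefore stays a power
  \<open>m ^ f i\<close>: raising adds 1 to \<open>f\<close>, and migration appends a 0 to the sequence
  \<open>f 0, \<dots>, f T\<close> (\<open>power_profile_raise\<close>, \<open>power_profile_migration\<close>).

  Thus \<open>(MR)^k\<close> yields \<open>f = (k, k - 1, \<dots>, 0)\<close>. A raise without a migration makes \<open>f\<close>
  drop by 2 from \<open>i = k\<close> to \<open>i = k + 1\<close>; a migration without a raise, \<open>B\<close> steps later, makes
  two neighbouring values equal (for \<open>B = 0\<close> the two effects cancel). For \<open>T = 2 k + B + 1\<close> the result is \<open>f i = T - i\<close>, except that
  \<open>f i = T - 1 - i\<close> for the \<open>B\<close> exponents \<open>k < i \<le> k + B\<close>.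

  The Young diagram is the union of the rectangles of \<open>m ^ i\<close> columns and \<open>m ^ f i\<close> rows.
  Transposition maps each pair \<open>(i, f i)\<close> to such a pair, except for \<open>i = k + B\<close> when
  \<open>B > 0\<close>; there \<open>(k + B, k)\<close> goes to \<open>(k, k + B)\<close>, and that rectangle lies inside the one
  of \<open>(k, f k) = (k, k + B + 1)\<close>. So the diagram is symmetric
  (\<open>self_conjugate_if_power_profile\<close>).

  The choice of \<open>B\<close> makes the size a power of \<open>m\<close>. Counting the diagram by columns gives
  \<open>m ^ T + (m - 1) * (\<Sum>i<T. m ^ (i + f (i + 1)))\<close>, in which the exponent is \<open>T - 2\<close> for
  \<open>B\<close> of the terms and \<open>T - 1\<close> for the other \<open>2 k + 1\<close>. Since \<open>B = m * (m - 2 k - 1)\<close>,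
  the terms add up to \<open>m ^ (T - 1) * m\<close>, and the size is \<open>m ^ (T + 1)\<close>.
\<close>

section \<open>Partitions and their conjugates through tail counts\<close>

definition parts_ge :: "nat multiset \<Rightarrow> nat \<Rightarrow> nat" where
  "parts_ge lam a = size {#p \<in># lam. a \<le> p#}"

lemma parts_ge_antimono: "a \<le> b \<Longrightarrow> parts_ge lam b \<le> parts_ge lam a"
  unfolding parts_ge_def by (induction lam) auto

lemma parts_ge_pos_iff: "0 < parts_ge lam a \<longleftrightarrow> (\<exists>p\<in>#lam. a \<le> p)"
  unfolding parts_ge_def by (induction lam) auto

lemma parts_ge_Suc: "parts_ge lam p = count lam p + parts_ge lam (Suc p)"
  unfolding parts_ge_def by (induction lam) auto

lemma multiset_eq_if_parts_ge_eq:
  assumes "0 \<notin># A" and "0 \<notin># B" and eq: "\<And>b. 1 \<le> b \<Longrightarrow> parts_ge A b = parts_ge B b"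
  shows "A = B"
proof (rule multiset_eqI)
  fix p
  show "count A p = count B p"
  proof (cases "p = 0")
    case True
    thus ?thesis using assms(1,2) by (simp add: not_in_iff)
  next
    case False
    thus ?thesis using eq[of p] eq[of "Suc p"] parts_ge_Suc[of A p] parts_ge_Suc[of B p] by simp
  qed
qed

text \<open>The hypothesis says that the Young diagram, whose column \<open>a\<close> has \<open>parts_ge lam a\<close>
  cells, is invariant under transposition. The columns of height at least \<open>b\<close> are then exactly
  the first \<open>parts_ge lam b\<close>, so the conjugate has the same tail counts as \<open>lam\<close>.\<close>

lemma self_conjugate_if_symmetric:
  assumes "0 \<notin># lam"
    and sym: "\<And>a b. 1 \<le> a \<Longrightarrow> 1 \<le> b \<Longrightarrow> b \<le> parts_ge lam a \<Longrightarrow> a \<le> parts_ge lam b"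
  shows "self_conjugate lam"
proof -
  define P where "P = Max (insert 0 (set_mset lam))"
  have part_le: "p \<le> P" if "p \<in># lam" for p
    unfolding P_def using that by simp
  have P_in: "P \<in> insert 0 (set_mset lam)"
    unfolding P_def by (intro Max_in) auto
  have conj: "conjugate lam = image_mset (parts_ge lam) (mset_set {1..P})"
    unfolding conjugate_def P_def parts_ge_def ..
  have "0 \<notin># conjugate lam"
  proof
    assume "0 \<in># conjugate lam"
    then obtain j where j: "1 \<le> j" "j \<le> P" "parts_ge lam j = 0"
      unfolding conj by (auto simp del: One_nat_def)
    hence "P \<in># lam" using P_in by auto
    with j(2) have "0 < parts_ge lam j" unfolding parts_ge_pos_iff by blast
    with j(3) show False by simp
  qed
  moreover have "parts_ge lam b = parts_ge (conjugate lam) b" if b: "1 \<le> b" for b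
  proof -
    have le_P: "parts_ge lam b \<le> P"
    proof (cases "parts_ge lam b = 0")
      case False
      hence "b \<le> parts_ge lam (parts_ge lam b)"
        using sym[of b "parts_ge lam b"] b by simp
      with b have "0 < parts_ge lam (parts_ge lam b)" by simp
      thus ?thesis unfolding parts_ge_pos_iff using part_le order_trans by blast
    qed simp
    have "parts_ge (conjugate lam) b = card {j \<in> {1..P}. b \<le> parts_ge lam j}"
      unfolding conj
      unfolding parts_ge_def[of "image_mset f A" for f A] filter_mset_image_mset size_image_mset
      by simp
    also have "{j \<in> {1..P}. b \<le> parts_ge lam j} = {1..parts_ge lam b}"
      using sym[of b] sym[of _ b] b le_P by (auto simp: Suc_le_eq)
    finally show ?thesis by simp
  qed
  ultimately show ?thesis
    unfolding self_conjugate_def using multiset_eq_if_parts_ge_eq assms(1) by blast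
qed

section \<open>The operators as operations on multisets\<close>

text \<open>The integer \<open>T\<close> only has to bound the exponents here. It becomes the largest exponent
  once there is a part at least \<open>m ^ T\<close>.\<close>

definition power_parts :: "nat \<Rightarrow> nat \<Rightarrow> nat multiset \<Rightarrow> bool" where
  "power_parts m T lam \<longleftrightarrow> (\<forall>p\<in>#lam. \<exists>i\<le>T. p = m ^ i)"

lemma of_mults_rev_upt:
  "of_mults m (map g (rev [0..<n])) = (\<Sum>i<n. replicate_mset (g i) (m ^ i))"
  by (induction n) (simp_all add: add.commute)

lemma power_parts_decompose:
  assumes "m \<ge> 2" and "power_parts m T lam"
  shows "lam = (\<Sum>i<Suc T. replicate_mset (count lam (m ^ i)) (m ^ i))"
proof (rule multiset_eqI)
  fix p
  have "count (\<Sum>i<Suc T. replicate_mset (count lam (m ^ i)) (m ^ i)) p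
          = (\<Sum>i<Suc T. if m ^ i = p then count lam p else 0)"
    unfolding count_sum by (intro sum.cong) auto
  also have "\<dots> = count lam p"
  proof (cases "\<exists>i\<le>T. p = m ^ i")
    case True
    then obtain e where e: "e \<le> T" "p = m ^ e" by blast
    have "(\<Sum>i<Suc T. if m ^ i = p then count lam p else 0)
            = (\<Sum>i<Suc T. if i = e then count lam p else 0)"
      using e(2) assms(1) by (intro sum.cong) (auto simp: power_inject_exp)
    thus ?thesis using e(1) by simp
  next
    case False
    hence "count lam p = 0"
      using assms(2) unfolding power_parts_def by (auto simp: count_eq_zero_iff)
    thus ?thesis by simp
  qed
  finally show "count lam p = count (\<Sum>i<Suc T. replicate_mset (count lam (m ^ i)) (m ^ i)) p" ..
qed

context
  fixes m T :: nat and lam :: "nat multiset"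
  assumes m: "m \<ge> 2" and powers: "power_parts m T lam" and top: "m ^ T \<in># lam"
begin

lemma top_exponent_eq: "top_exponent m lam = T"
  unfolding top_exponent_def
proof (rule Greatest_equality)
  fix i assume "m ^ i \<in># lam"
  then obtain e where "e \<le> T" "m ^ i = m ^ e"
    using powers unfolding power_parts_def by blast
  thus "i \<le> T" using m by (simp add: power_inject_exp)
qed (rule top)

lemma mults_eq: "mults m lam = map (\<lambda>i. count lam (m ^ i)) (rev [0..<Suc T])"
  unfolding mults_def top_exponent_eq ..

lemma raise_eq_repeat_mset: "raise m lam = repeat_mset m lam"
proof -
  have "raise m lam = (\<Sum>i<Suc T. replicate_mset (m * count lam (m ^ i)) (m ^ i))"
    unfolding raise_def mults_eq map_map of_mults_rev_upt by (simp only: comp_def)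
  also have "\<dots> = repeat_mset m (\<Sum>i<Suc T. replicate_mset (count lam (m ^ i)) (m ^ i))"
    by (rule multiset_eqI) (simp only: count_sum count_repeat_mset count_replicate_mset
        sum_distrib_left if_distrib mult_0_right cong: if_cong)
  also have "\<dots> = repeat_mset m lam" using power_parts_decompose[OF m powers] by argo
  finally show ?thesis .
qed

lemma migration_eq: "migration m lam = add_mset (m ^ Suc T) (lam - {#m ^ T#})"
proof -
  let ?a = "count lam (m ^ T)"
  let ?rest = "map (\<lambda>i. count lam (m ^ i)) (rev [0..<T])"
  have "0 < ?a" using top by simp
  then obtain c where c: "?a = Suc c" using gr0_implies_Suc by blast
  have "lam = of_mults m (map (\<lambda>i. count lam (m ^ i)) (rev [0..<Suc T]))"
    unfolding of_mults_rev_upt by (rule power_parts_decompose[OF m powers])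
  also have "\<dots> = add_mset (m ^ T) (replicate_mset c (m ^ T) + of_mults m ?rest)"
    by (simp add: c)
  finally have "lam - {#m ^ T#} = replicate_mset c (m ^ T) + of_mults m ?rest"
    by (metis add_mset_remove_trivial)
  thus ?thesis
    unfolding migration_def mults_eq Let_def by (simp add: c)
qed

end

section \<open>Partitions whose tail counts are powers\<close>

definition power_profile :: "nat \<Rightarrow> nat \<Rightarrow> (nat \<Rightarrow> nat) \<Rightarrow> nat multiset \<Rightarrow> bool" where
  "power_profile m T f lam \<longleftrightarrow>
     power_parts m T lam \<and> (\<forall>i\<le>T. parts_ge lam (m ^ i) = m ^ f i)"

lemma power_profile_cong:
  assumes "power_profile m T f lam" and "T = T'" and "\<And>i. i \<le> T \<Longrightarrow> f i = f' i"
  shows "power_profile m T' f' lam"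
  using assms unfolding power_profile_def by auto

lemma power_profile_top:
  assumes "m \<ge> 2" and "power_profile m T f lam"
  shows "m ^ T \<in># lam"
proof -
  have "0 < parts_ge lam (m ^ T)"
    using assms unfolding power_profile_def by simp
  then obtain p where p: "p \<in># lam" "m ^ T \<le> p" unfolding parts_ge_pos_iff by blast
  then obtain e where e: "e \<le> T" "p = m ^ e"
    using assms(2) unfolding power_profile_def power_parts_def by blast
  with p(2) assms(1) have "T \<le> e" by (simp add: power_increasing_iff)
  with e p(1) show ?thesis by simp
qed

lemma power_profile_raise:
  assumes m: "m \<ge> 2" and prof: "power_profile m T f lam"
  shows "power_profile m T (\<lambda>i. Suc (f i)) (raise m lam)"
proof -
  have powers: "power_parts m T lam" using prof unfolding power_profile_def by blast
  have raise: "raise m lam = repeat_mset m lam"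
    using raise_eq_repeat_mset[OF m powers power_profile_top[OF m prof]] .
  have "set_mset (raise m lam) = set_mset lam"
    unfolding raise using m by (intro set_eqI) (simp flip: count_greater_zero_iff)
  moreover have "parts_ge (raise m lam) a = m * parts_ge lam a" for a
    unfolding raise parts_ge_def by (induction m) simp_all
  ultimately show ?thesis
    using prof unfolding power_profile_def power_parts_def by simp
qed

lemma power_profile_migration:
  assumes m: "m \<ge> 2" and prof: "power_profile m T f lam"
  shows "power_profile m (Suc T) (f(Suc T := 0)) (migration m lam)"
proof -
  have powers: "power_parts m T lam" using prof unfolding power_profile_def by blast
  have top: "m ^ T \<in># lam" by (rule power_profile_top[OF m prof])
  define rest where "rest = lam - {#m ^ T#}"
  have lam: "lam = add_mset (m ^ T) rest" unfolding rest_def using top by simp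
  have mig: "migration m lam = add_mset (m ^ Suc T) rest"
    unfolding rest_def by (rule migration_eq[OF m powers top])
  have parts: "power_parts m (Suc T) (migration m lam)"
    unfolding power_parts_def
  proof
    fix p assume "p \<in># migration m lam"
    hence "p = m ^ Suc T \<or> p \<in># lam" unfolding mig unfolding lam by auto
    thus "\<exists>i\<le>Suc T. p = m ^ i" using powers unfolding power_parts_def by (auto intro: le_SucI)
  qed
  have less: "m ^ T < m ^ Suc T" using m by simp
  have old: "parts_ge (migration m lam) (m ^ i) = parts_ge lam (m ^ i)" if "i \<le> T" for i
  proof -
    have "m ^ i \<le> m ^ T" using m that by (simp add: power_increasing_iff)
    moreover from this less have "m ^ i \<le> m ^ Suc T" by linarith
    ultimately show ?thesis unfolding mig unfolding parts_ge_def lam by simp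
  qed
  have "p < m ^ Suc T" if "p \<in># rest" for p
  proof -
    from that powers obtain e where "e \<le> T" "p = m ^ e"
      unfolding lam power_parts_def by auto
    thus ?thesis using m by (simp only: power_strict_increasing_iff)
  qed
  hence "{#p \<in># rest. m ^ Suc T \<le> p#} = {#}" by (fastforce simp: filter_mset_eq_conv)
  hence "parts_ge (migration m lam) (m ^ Suc T) = 1"
    unfolding mig parts_ge_def by (simp del: power_Suc)
  with parts old prof show ?thesis
    unfolding power_profile_def by (auto simp: le_Suc_eq)
qed

lemma power_profile_migration_raise_iterate:
  assumes m: "m \<ge> 2" and prof: "power_profile m T f lam"
  shows "power_profile m (T + j) (\<lambda>i. if i \<le> T then f i + j else T + j - i)
           (((migration m \<circ> raise m) ^^ j) lam)"
proof (induction j)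
  case 0
  show ?case using prof by (auto intro: power_profile_cong)
next
  case (Suc j)
  from power_profile_migration[OF m power_profile_raise[OF m Suc.IH]]
  show ?case unfolding funpow.simps comp_apply
    by (rule power_profile_cong) auto
qed

text \<open>For \<open>p = m ^ e\<close> the geometric sum gives \<open>p = 1 + (m - 1) * (\<Sum>i<e. m ^ i)\<close>; the
  term \<open>m ^ i\<close> occurs exactly if \<open>p\<close> is at least \<open>m ^ (i + 1)\<close>. In the Young diagram, the
  \<open>(m - 1) * m ^ i\<close> columns \<open>m ^ i < a \<le> m ^ (i + 1)\<close> all have the height
  \<open>parts_ge lam (m ^ (i + 1))\<close>.\<close>

lemma sum_mset_power_parts:
  assumes m: "m \<ge> 2" and "power_parts m T lam"
  shows "\<Sum>\<^sub># lam = parts_ge lam 1 + (m - 1) * (\<Sum>i<T. m ^ i * parts_ge lam (m ^ Suc i))"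
  using assms(2)
proof (induction lam)
  case empty
  show ?case by (simp add: parts_ge_def)
next
  case (add p lam)
  from add.prems obtain e where e: "e \<le> T" "p = m ^ e" and lam: "power_parts m T lam"
    unfolding power_parts_def by auto
  have geometric: "m ^ e = 1 + (m - 1) * (\<Sum>i<e. m ^ i)" for e
  proof (induction e)
    case (Suc e)
    have "m ^ Suc e = m ^ e + (m - 1) * m ^ e"
      using m by (cases m) simp_all
    also have "\<dots> = 1 + (m - 1) * (\<Sum>i<e. m ^ i) + (m - 1) * m ^ e"
      by (simp only: Suc.IH[symmetric])
    finally show ?case by (simp only: sum.lessThan_Suc distrib_left add.assoc)
  qed simp
  have tail: "parts_ge (add_mset p lam) (m ^ Suc i) = of_bool (i < e) + parts_ge lam (m ^ Suc i)" for i
    using m e(2) unfolding parts_ge_def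
    by (auto simp: power_increasing_iff Suc_le_eq simp del: power_Suc)
  have head: "parts_ge (add_mset p lam) 1 = 1 + parts_ge lam 1"
    using m e(2) unfolding parts_ge_def by (simp add: Suc_le_eq)
  have "(\<Sum>i<T. m ^ i * of_bool (i < e)) = (\<Sum>i<e. m ^ i)"
    using e(1) by (intro sum.mono_neutral_cong_right) auto
  hence "(\<Sum>i<T. m ^ i * parts_ge (add_mset p lam) (m ^ Suc i))
           = (\<Sum>i<e. m ^ i) + (\<Sum>i<T. m ^ i * parts_ge lam (m ^ Suc i))"
    unfolding tail distrib_left sum.distrib by (simp only:)
  moreover have "\<Sum>\<^sub># (add_mset p lam) = m ^ e + \<Sum>\<^sub># lam" using e(2) by simp
  ultimately show ?case
    unfolding head using add.IH[OF lam] geometric[of e] by (simp only: distrib_left ac_simps)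
qed

text \<open>No part lies strictly between consecutive powers of \<open>m\<close>, so the cell \<open>(a, b)\<close> belongs
  to the Young diagram iff some \<open>i \<le> T\<close> has \<open>a \<le> m ^ i\<close> and \<open>b \<le> m ^ f i\<close>. The
  hypothesis covers the transpose of each of these rectangles by one of them.\<close>

lemma self_conjugate_if_power_profile:
  assumes m: "m \<ge> 2" and prof: "power_profile m T f lam"
    and sym: "\<And>i. i \<le> T \<Longrightarrow> \<exists>j\<le>T. i \<le> f j \<and> f i \<le> j"
  shows "self_conjugate lam"
proof (rule self_conjugate_if_symmetric)
  have powers: "\<And>p. p \<in># lam \<Longrightarrow> \<exists>i\<le>T. p = m ^ i"
    and tail: "\<And>i. i \<le> T \<Longrightarrow> parts_ge lam (m ^ i) = m ^ f i"
    using prof unfolding power_profile_def power_parts_def by auto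
  show "0 \<notin># lam" using powers[of 0] m by auto
  fix a b :: nat
  assume "1 \<le> a" "1 \<le> b" and b: "b \<le> parts_ge lam a"
  define i where "i = (LEAST i. a \<le> m ^ i)"
  from \<open>1 \<le> b\<close> b have "0 < parts_ge lam a" by linarith
  then obtain p where "p \<in># lam" "a \<le> p" unfolding parts_ge_pos_iff by blast
  then obtain e where e: "e \<le> T" "a \<le> m ^ e" using powers by blast
  have least: "i \<le> e'" if "a \<le> m ^ e'" for e'
    unfolding i_def using that by (rule Least_le)
  have a: "a \<le> m ^ i" unfolding i_def using e(2) by (rule LeastI)
  have iT: "i \<le> T" using least[OF e(2)] e(1) by simp
  have "a \<le> p \<longleftrightarrow> m ^ i \<le> p" if "p \<in># lam" for p
  proof
    assume "a \<le> p"
    with powers[OF that] least show "m ^ i \<le> p" using m by (auto simp: power_increasing_iff)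
  qed (use a in linarith)
  hence "parts_ge lam a = parts_ge lam (m ^ i)"
    unfolding parts_ge_def by (metis (mono_tags, lifting) filter_mset_cong0)
  with tail[OF iT] b have b: "b \<le> m ^ f i" by simp
  obtain j where j: "j \<le> T" "i \<le> f j" "f i \<le> j" using sym[OF iT] by blast
  have "b \<le> m ^ j" using b j(3) m by (meson order_trans power_increasing one_le_numeral)
  hence "parts_ge lam (m ^ j) \<le> parts_ge lam b" by (rule parts_ge_antimono)
  moreover have "a \<le> m ^ f j"
    using a j(2) m by (meson order_trans power_increasing one_le_numeral)
  ultimately show "a \<le> parts_ge lam b" using tail[OF j(1)] by simp
qed

section \<open>The generated partition\<close>

lemma power_profile_one: "power_profile m 0 (\<lambda>i. 0) (of_mults m [1])"
  unfolding power_profile_def power_parts_def parts_ge_def by simp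

lemma power_profile_generated:
  assumes m: "m \<ge> 2"
  defines "M \<equiv> migration m" and "R \<equiv> raise m"
  shows "power_profile m (2 * k + B + 1)
           (\<lambda>i. if k < i \<and> i \<le> k + B then 2 * k + B - i else 2 * k + B + 1 - i)
           ((((M \<circ> R) ^^ k) \<circ> M \<circ> ((M \<circ> R) ^^ B) \<circ> R \<circ> ((M \<circ> R) ^^ k)) (of_mults m [1]))"
proof -
  note iterate = power_profile_migration_raise_iterate[OF m, folded M_def R_def]
  note R = power_profile_raise[OF m, folded R_def]
  note M = power_profile_migration[OF m, folded M_def]
  have "power_profile m k (\<lambda>i. k + 1 - i) (R (((M \<circ> R) ^^ k) (of_mults m [1])))"
    by (rule power_profile_cong[OF R[OF iterate[OF power_profile_one]]]) auto
  from M[OF iterate[OF this]]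
  have "power_profile m (k + B + 1) (\<lambda>i. if i \<le> k then k + B + 1 - i else k + B - i)
          (M (((M \<circ> R) ^^ B) (R (((M \<circ> R) ^^ k) (of_mults m [1])))))"
    by (rule power_profile_cong) auto
  from iterate[OF this] show ?thesis
    unfolding comp_apply by (rule power_profile_cong) auto
qed

theorem theorem5p3:
  fixes m k B :: nat
  assumes "m \<ge> 2"
    and "real k \<le> (real m - 1) / 2"
    and "int B = int m ^ 2 - (2 * int k + 1) * int m"
  shows "let M = migration m; R = raise m;
             lam = (((M \<circ> R) ^^ k) \<circ> M \<circ> ((M \<circ> R) ^^ B) \<circ> R \<circ> ((M \<circ> R) ^^ k)) (of_mults m [1])
         in is_partition lam (m ^ (B + 2 * (k + 1))) \<and> CMP m lam \<and> self_conjugate lam"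
proof -
  define lam where "lam = (((migration m \<circ> raise m) ^^ k) \<circ> migration m
    \<circ> ((migration m \<circ> raise m) ^^ B) \<circ> raise m \<circ> ((migration m \<circ> raise m) ^^ k)) (of_mults m [1])"
  define T where "T = 2 * k + B + 1"
  define f where "f = (\<lambda>i. if k < i \<and> i \<le> k + B then 2 * k + B - i else 2 * k + B + 1 - i)"
  have prof: "power_profile m T f lam"
    unfolding T_def f_def lam_def by (rule power_profile_generated[OF assms(1)])
  hence powers: "power_parts m T lam" and tail: "\<And>i. i \<le> T \<Longrightarrow> parts_ge lam (m ^ i) = m ^ f i"
    unfolding power_profile_def by auto
  have zero: "0 \<notin># lam"
    using powers assms(1) unfolding power_parts_def by auto

  have self_conj: "self_conjugate lam"
  proof (rule self_conjugate_if_power_profile[OF assms(1) prof])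
    fix i assume i: "i \<le> T"
    show "\<exists>j\<le>T. i \<le> f j \<and> f i \<le> j"
    proof (cases "k < i \<and> i \<le> k + B")
      case True
      \<comment> \<open>Transposition permutes the short rectangles \<open>k < i < k + B\<close>; the last one goes
        into the long rectangle at \<open>k\<close>.\<close>
      show ?thesis
        by (rule exI[of _ "2 * k + B - i"]) (use True in \<open>auto simp: f_def T_def\<close>)
    next
      case False
      show ?thesis
        by (rule exI[of _ "T - i"]) (use False i in \<open>auto simp: f_def T_def\<close>)
    qed
  qed

  have "2 * k + 1 \<le> m" using assms(2) by (simp add: field_simps)
  then obtain d where d: "m = 2 * k + 1 + d" using le_Suc_ex by blast
  have "int B = int (m * d)"
    unfolding assms(3) using d by (simp add: power2_eq_square algebra_simps)
  hence B: "B = m * d" by (simp only: of_nat_eq_iff)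
  have "(\<Sum>i<T. m ^ i * parts_ge lam (m ^ Suc i)) = (\<Sum>i<T. m ^ (i + f (Suc i)))"
    using tail by (intro sum.cong) (auto simp: power_add simp del: power_Suc)
  also have "\<dots> = (\<Sum>i<T. if k \<le> i \<and> i < k + B then m ^ (2 * k + B - 1) else m ^ (2 * k + B))"
    by (intro sum.cong) (auto simp: f_def T_def)
  also have "\<dots> = B * m ^ (2 * k + B - 1) + (2 * k + 1) * m ^ (2 * k + B)"
  proof -
    have "{..<T} \<inter> {i. k \<le> i \<and> i < k + B} = {k..<k + B}"
      and "{..<T} \<inter> - {i. k \<le> i \<and> i < k + B} = {..<k} \<union> {k + B..<T}"
      unfolding T_def by auto
    moreover have "card ({..<k} \<union> {k + B..<T}) = 2 * k + 1"
      unfolding T_def by (subst card_Un_disjoint) auto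
    ultimately show ?thesis by (simp add: sum.If_cases)
  qed
  also have "B * m ^ (2 * k + B - 1) = d * m ^ (2 * k + B)"
  proof (cases "B = 0")
    \<comment> \<open>Here \<open>2 * k + B - 1\<close> may truncate, but both sides vanish.\<close>
    case True
    thus ?thesis using B assms(1) by simp
  next
    case False
    hence "m ^ (2 * k + B) = m * m ^ (2 * k + B - 1)"
      by (metis add_is_0 power_eq_if)
    moreover have "B * x = d * (m * x)" for x using B by simp
    ultimately show ?thesis by (simp only:)
  qed
  also have "d * m ^ (2 * k + B) + (2 * k + 1) * m ^ (2 * k + B) = m * m ^ (2 * k + B)"
    using d by (metis add.commute distrib_right)
  finally have weights: "(\<Sum>i<T. m ^ i * parts_ge lam (m ^ Suc i)) = m ^ T"
    unfolding T_def by simp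
  have "parts_ge lam 1 = m ^ T"
    using tail[of 0] by (simp add: f_def T_def)
  hence "\<Sum>\<^sub># lam = m ^ T + (m - 1) * m ^ T"
    using sum_mset_power_parts[OF assms(1) powers] weights by simp
  also have "\<dots> = m * m ^ T" using assms(1) by (simp add: diff_mult_distrib)
  also have "\<dots> = m ^ (B + 2 * (k + 1))" unfolding T_def by (simp add: algebra_simps)
  finally have partition: "is_partition lam (m ^ (B + 2 * (k + 1)))"
    unfolding is_partition_def using zero by blast
  hence "m_ary m lam"
    using powers assms(1) unfolding m_ary_def power_parts_def
    by (meson pos2 order_less_le_trans zero_less_power)
  hence "CMP m lam"
    using self_conj unfolding CMP_def conjugate_ary_def self_conjugate_def by simp
  with partition self_conj show ?thesis
    unfolding lam_def Let_def by blast
qed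

end
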